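(* Let $a, b$ be nonnegative integers with $a \ge 1$, and let $G$ be a finite simple graph. If $\mathrm{mad}(G) < \frac{4}{3}a + b$, then $G$ is $(1_1, 1_2, \ldots, 1_a, 0_1, \ldots, 0_b)$-colorable.
   Context: For nonnegative integers $a,b,d$, a graph $G$ is $(d_1, \ldots, d_a, 0_1, \ldots, 0_b)$-colorable if $V(G)$ can be partitioned into $b$ independent sets $O_1,\ldots,O_b$ and $a$ sets $D_1,\ldots,D_a$ such that each induced subgraph $G[D_i]$ has maximum degree at most $d$. The maximum average degree $\mathrm{mad}(G)$ is the maximum, over all subgraphs $H$ of $G$, of the average degree $2|E(H)|/|V(H)|$. *)

theory Defs
  imports Complex_Main "HOL-Library.Disjoint_Sets" "Graph_Theory.Graph_Theory"
begin

text \<open>A finite simple graph is a \<^const>\<open>pair_graph\<close>: a finite, symmetric, irreflexive arc set on a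
  finite vertex set, in which every undirected edge appears as two opposite arcs.\<close>

definition uedges :: "'a pair_pre_digraph \<Rightarrow> 'a set set" where
  "uedges G = (\<lambda>(u, v). {u, v}) ` parcs G"

definition average_degree :: "'a pair_pre_digraph \<Rightarrow> real" where
  "average_degree G = 2 * real (card (uedges G)) / real (card (pverts G))"

definition subgraphs :: "'a pair_pre_digraph \<Rightarrow> 'a pair_pre_digraph set" where
  "subgraphs G = {H. pair_graph H \<and> subgraph (with_proj H) (with_proj G)}"

text \<open>The null subgraph contributes \<open>0 / 0 = 0\<close>. This is also the average degree of a one-vertex
  subgraph, so it affects the maximum only by giving the null graph the value 0.\<close>

definition mad :: "'a pair_pre_digraph \<Rightarrow> real" where
  "mad G = Max (average_degree ` subgraphs G)"

definition independent_set :: "'a pair_pre_digraph \<Rightarrow> 'a set \<Rightarrow> bool" where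
  "independent_set G S \<longleftrightarrow> S \<subseteq> pverts G \<and> (\<forall>u\<in>S. \<forall>v\<in>S. (u, v) \<notin> parcs G)"

text \<open>In a symmetric digraph the out-degree of a vertex is its number of neighbours. Stating the
  bound vertexwise also covers the graph without vertices.\<close>

definition max_degree_at_most :: "('a, 'b) pre_digraph \<Rightarrow> nat \<Rightarrow> bool" where
  "max_degree_at_most G d \<longleftrightarrow> (\<forall>v\<in>verts G. out_degree G v \<le> d)"

text \<open>\<open>defective_colorable d a b G\<close> is \<open>(d\<^sub>1, \<dots>, d\<^sub>a, 0\<^sub>1, \<dots>, 0\<^sub>b)\<close>-colorability.
  As usual for colorings, classes may be empty.\<close>

definition defective_colorable :: "nat \<Rightarrow> nat \<Rightarrow> nat \<Rightarrow> 'a pair_pre_digraph \<Rightarrow> bool" where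
  "defective_colorable d a b G \<longleftrightarrow>
    (\<exists>(Ds :: nat \<Rightarrow> 'a set) (Os :: nat \<Rightarrow> 'a set).
      (\<Union>i\<in>{1..a}. Ds i) \<union> (\<Union>j\<in>{1..b}. Os j) = pverts G \<and>
      disjoint_family_on Ds {1..a} \<and>
      disjoint_family_on Os {1..b} \<and>
      (\<Union>i\<in>{1..a}. Ds i) \<inter> (\<Union>j\<in>{1..b}. Os j) = {} \<and>
      (\<forall>j\<in>{1..b}. independent_set G (Os j)) \<and>
      (\<forall>i\<in>{1..a}. max_degree_at_most (with_proj G \<restriction> Ds i) d))"

lemma finite_subgraphs:
  assumes "pair_graph G"
  shows "finite (subgraphs G)"
proof -
  interpret pair_graph G by fact
  have "subgraphs G \<subseteq> (\<lambda>(V, E). \<lparr>pverts = V, parcs = E\<rparr>) ` (Pow (pverts G) \<times> Pow (parcs G))"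
  proof
    fix H assume "H \<in> subgraphs G"
    then have "pverts H \<subseteq> pverts G" "parcs H \<subseteq> parcs G"
      by (auto simp: subgraphs_def subgraph_def)
    then show "H \<in> (\<lambda>(V, E). \<lparr>pverts = V, parcs = E\<rparr>) ` (Pow (pverts G) \<times> Pow (parcs G))"
      by (intro image_eqI[where x = "(pverts H, parcs H)"]) auto
  qed
  moreover have "finite (Pow (pverts G) \<times> Pow (parcs G))"
    using pair_finite_verts pair_finite_arcs by simp
  ultimately show ?thesis
    by (meson finite_imageI finite_subset)
qed

lemma self_in_subgraphs:
  assumes "pair_graph G"
  shows "G \<in> subgraphs G"
proof -
  interpret pair_graph G by fact
  show ?thesis
    using assms wf_digraph_axioms by (auto simp: subgraphs_def subgraph_def compatible_def)
qed

end

theory Submission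
  imports Defs "HOL-Analysis.Function_Topology"
begin

text \<open>Split two units of weight on every edge between its endpoints, minimising the sum of the squared
  vertex loads plus a small multiple of the sum of the squared shares. Shifting weight on a single
  edge shows that at the minimum all loads are below \<open>4a/3 + b\<close>, and that of two adjacent vertices the one
  with the smaller load carries at least one unit of their edge. Hence \<open>b\<close> successive greedy
  independent sets, chosen in order of decreasing load, lower the load of every remaining vertex by
  \<open>b\<close>, and the graph \<open>R\<close> that is left has \<open>mad < 4a/3\<close>.

  In \<open>R\<close> delete, as long as possible, vertices with \<open>\<ell> + 2h \<ge> 2a\<close>, where \<open>\<ell>\<close> and \<open>h\<close> count the remaining
  and the deleted neighbors. If everything were deleted, each edge would be counted three times and
  \<open>3|E| \<ge> 2a|R|\<close>, a contradiction. So a nonempty set \<open>L\<close> with \<open>\<ell> + 2h < 2a\<close> survives. Color the rest by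
  induction; a vertex of \<open>L\<close> has at least \<open>a - h > \<ell>/2\<close> colors not seen outside \<open>L\<close>, so a coloring of \<open>L\<close>
  from these lists with the fewest monochromatic edges has defect at most 1.\<close>

section \<open>Degrees inside vertex sets and coloring with defect 1\<close>

definition degree_in :: "('a \<Rightarrow> 'a \<Rightarrow> bool) \<Rightarrow> 'a set \<Rightarrow> 'a \<Rightarrow> nat" where
  "degree_in E H v = card {u \<in> H. E v u}"

lemma degree_in_insert:
  assumes "finite H" "x \<notin> H"
  shows "degree_in E (insert x H) v = degree_in E H v + of_bool (E v x)"
proof -
  have "{u \<in> insert x H. E v u} = (if E v x then insert x {u \<in> H. E v u} else {u \<in> H. E v u})"
    by auto
  then show ?thesis
    using assms by (simp add: degree_in_def)
qed

lemma degree_in_conv_sum: "finite H \<Longrightarrow> degree_in E H v = (\<Sum>u\<in>H. of_bool (E v u))"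
  by (simp add: degree_in_def Int_def)

lemma sum_adjacent_eq_degree_in:
  assumes "finite H" "symp E"
  shows "(\<Sum>v\<in>H. of_bool (E v x)) = degree_in E H x"
proof -
  have "E v x = E x v" for v
    using assms(2) by (auto dest: sympD)
  then show ?thesis
    using assms(1) by (simp only: degree_in_conv_sum)
qed

lemma sum_degree_in_insert:
  assumes "finite H" "x \<notin> H" "symp E" "irreflp E"
  shows "(\<Sum>v\<in>insert x H. degree_in E (insert x H) v) =
    (\<Sum>v\<in>H. degree_in E H v) + 2 * degree_in E H x"
proof -
  have "(\<Sum>v\<in>H. of_bool (E v x)) = degree_in E H x"
    using assms(1,3) by (rule sum_adjacent_eq_degree_in)
  moreover have "\<not> E x x"
    using assms by (simp add: irreflpD)
  ultimately show ?thesis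
    using assms by (simp add: degree_in_insert sum.distrib)
qed

text \<open>In a list coloring with the fewest monochromatic edges, moving a vertex to
  another color of its list cannot help, so its neighbors are spread evenly over its list.\<close>

lemma defective_list_coloring:
  fixes F :: "'a \<Rightarrow> 'c set"
  assumes "finite L" "symp E" "irreflp E"
    and fin: "\<And>v. v \<in> L \<Longrightarrow> finite (F v)"
    and lt: "\<And>v. v \<in> L \<Longrightarrow> degree_in E L v < Suc d * card (F v)"
  obtains c where "\<And>v. v \<in> L \<Longrightarrow> c v \<in> F v"
    and "\<And>v. v \<in> L \<Longrightarrow> degree_in (\<lambda>x y. E x y \<and> c x = c y) L v \<le> d"
proof -
  define mono where "mono c x y \<longleftrightarrow> E x y \<and> c x = c y" for c :: "'a \<Rightarrow> 'c" and x y
  define M where "M c = (\<Sum>v\<in>L. degree_in (mono c) L v)" for c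
  have mono: "symp (mono c)" "irreflp (mono c)" for c
    using assms(2,3) by (auto simp: mono_def symp_def irreflp_def)
  have "F v \<noteq> {}" if "v \<in> L" for v
    using lt[OF that] by auto
  then have "\<forall>v\<in>L. (SOME i. i \<in> F v) \<in> F v"
    by (simp add: some_in_eq)
  then have "\<exists>c. (\<forall>v\<in>L. c v \<in> F v)"
    by (rule exI[where x="\<lambda>v. SOME i. i \<in> F v"])
  \<comment> \<open>As a degree sum, \<open>M c\<close> is twice the number of monochromatic edges;
    a coloring minimising it exists because its values are natural numbers.\<close>
  then obtain c where c: "\<forall>v\<in>L. c v \<in> F v" and min: "\<And>c'. \<forall>v\<in>L. c' v \<in> F v \<Longrightarrow> M c \<le> M c'"
    using ex_has_least_nat[of "\<lambda>c. \<forall>v\<in>L. c v \<in> F v" _ M] by blast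
  have "degree_in (mono c) L v \<le> d" if v: "v \<in> L" for v
  proof (rule ccontr)
    assume bad: "\<not> degree_in (mono c) L v \<le> d"
    define L' where "L' = L - {v}"
    have L': "finite L'" "v \<notin> L'" "L = insert v L'"
      using assms(1) v by (auto simp: L'_def)
    have M_eq: "M c' = (\<Sum>x\<in>L'. degree_in (mono c') L' x) + 2 * degree_in (mono c') L' v" for c'
      unfolding M_def L'(3) by (rule sum_degree_in_insert) (use L' mono in auto)
    have deg_L: "degree_in (mono c') L v = degree_in (mono c') L' v" for c'
      using L' mono(2)[of c'] by (simp add: degree_in_insert irreflp_def)
    \<comment> \<open>Recoloring \<open>v\<close> with \<open>i\<close> affects only edges at
      \<open>v\<close>. By minimality \<open>v\<close> has at least as many neighbors of color
      \<open>i\<close> as it now has neighbors of its own color, hence more than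
      \<open>d\<close>.\<close>
    have ge: "Suc d \<le> card {u \<in> L. E v u \<and> c u = i}" if i: "i \<in> F v" for i
    proof -
      have "M c \<le> M (c(v := i))"
        using c i by (intro min) auto
      moreover have "(\<Sum>x\<in>L'. degree_in (mono (c(v := i))) L' x) = (\<Sum>x\<in>L'. degree_in (mono c) L' x)"
        using L'(2) by (intro sum.cong refl) (auto simp: degree_in_def mono_def intro!: arg_cong[where f=card])
      ultimately have "degree_in (mono c) L' v \<le> degree_in (mono (c(v := i))) L' v"
        by (simp add: M_eq)
      also have "\<dots> \<le> card {u \<in> L. E v u \<and> c u = i}"
        unfolding degree_in_def using L' by (intro card_mono) (auto simp: mono_def)
      finally show ?thesis
        using bad by (simp add: deg_L)
    qed
    have "Suc d * card (F v) = (\<Sum>i\<in>F v. Suc d)"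
      by simp
    also have "\<dots> \<le> (\<Sum>i\<in>F v. card {u \<in> L. E v u \<and> c u = i})"
      by (rule sum_mono) (rule ge)
    also have "\<dots> = card (\<Union>i\<in>F v. {u \<in> L. E v u \<and> c u = i})"
      using assms(1) fin[OF v] by (subst card_UN_disjoint) auto
    also have "\<dots> \<le> degree_in E L v"
      unfolding degree_in_def using assms(1) by (intro card_mono) auto
    finally show False
      using lt[OF v] by simp
  qed
  with c show thesis
    by (intro that[of c]) (simp_all add: mono_def[abs_def])
qed

text \<open>When \<open>L\<close> is deleted vertex by vertex, an edge inside \<open>L\<close> counts once at its first deleted endpoint
  and twice at the other. Both sides are doubled, because the degree sum counts each edge twice.\<close>

lemma peeling_bound:
  assumes "finite R" "symp E" "irreflp E" "L \<subseteq> R"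
    and "\<And>L'. L' \<subseteq> L \<Longrightarrow> L' \<noteq> {} \<Longrightarrow> \<exists>v\<in>L'. k \<le> degree_in E L' v + 2 * degree_in E (R - L') v"
  shows "2 * k * card L \<le> 3 * (\<Sum>v\<in>L. degree_in E L v) + 4 * (\<Sum>v\<in>L. degree_in E (R - L) v)"
  using finite_subset[OF assms(4,1)] assms(4,5)
proof (induction L rule: finite_psubset_induct)
  case (psubset L)
  show ?case
  proof (cases "L = {}")
    case False
    then obtain v where v: "v \<in> L" "k \<le> degree_in E L v + 2 * degree_in E (R - L) v"
      using psubset.prems(2)[of L] by blast
    define L' where "L' = L - {v}"
    have L': "finite L'" "v \<notin> L'" "L = insert v L'" "L' \<subset> L"
      using psubset.hyps v by (auto simp: L'_def)
    have IH: "2 * k * card L' \<le> 3 * (\<Sum>x\<in>L'. degree_in E L' x) + 4 * (\<Sum>x\<in>L'. degree_in E (R - L') x)"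
      using psubset.prems L' by (intro psubset.IH) auto
    have RL': "R - L' = insert v (R - L)"
      using v psubset.prems(1) by (auto simp: L'_def)
    have "degree_in E (R - L') x = degree_in E (R - L) x + of_bool (E x v)" for x
      unfolding RL' using assms(1) v by (intro degree_in_insert) auto
    moreover have "(\<Sum>x\<in>L'. of_bool (E x v)) = degree_in E L' v"
      using L'(1) assms(2) by (rule sum_adjacent_eq_degree_in)
    ultimately have out: "(\<Sum>x\<in>L'. degree_in E (R - L') x) =
        (\<Sum>x\<in>L'. degree_in E (R - L) x) + degree_in E L' v"
      by (simp add: sum.distrib)
    have ins: "(\<Sum>x\<in>L. degree_in E L x) = (\<Sum>x\<in>L'. degree_in E L' x) + 2 * degree_in E L' v"
      unfolding L'(3) by (rule sum_degree_in_insert) (use L' assms in auto)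
    have "degree_in E L v = degree_in E L' v"
      using L' assms(3) by (simp add: degree_in_insert irreflp_def)
    moreover have "(\<Sum>x\<in>L. degree_in E (R - L) x) =
        (\<Sum>x\<in>L'. degree_in E (R - L) x) + degree_in E (R - L) v"
      using sum.insert[OF L'(1,2), of "degree_in E (R - L)"] by (simp add: L'(3)[symmetric])
    moreover have "card L = Suc (card L')"
      using L' by simp
    \<comment> \<open>With l neighbors of \<open>v\<close> in \<open>L'\<close> and h in
      \<open>R - L\<close>, passing from \<open>L'\<close> to \<open>L\<close> raises the right side
      by 6l + 4h - 4l = 2(l + 2h), which is at least 2k.\<close>
    ultimately show ?thesis
      using IH out ins v(2) by (simp add: algebra_simps)
  qed simp
qed

text \<open>The density hypothesis is \<open>mad < 4a/3\<close> for the graph on \<open>R\<close>,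
  cleared of fractions. It passes to subsets, which permits induction on \<open>R\<close>.\<close>

lemma defective_1_coloring:
  assumes "finite R" "symp E" "irreflp E"
    and "\<And>H. H \<subseteq> R \<Longrightarrow> H \<noteq> {} \<Longrightarrow> 3 * (\<Sum>v\<in>H. degree_in E H v) < 4 * a * card H"
  shows "\<exists>c. \<forall>v\<in>R. c v \<in> {1..a} \<and> degree_in (\<lambda>x y. E x y \<and> c x = c y) R v \<le> 1"
  using assms(1,4)
proof (induction R rule: finite_psubset_induct)
  case (psubset R)
  show ?case
  proof (cases "R = {}")
    case False
    have "\<exists>L\<subseteq>R. L \<noteq> {} \<and> (\<forall>v\<in>L. degree_in E L v + 2 * degree_in E (R - L) v < 2 * a)"
    proof (rule ccontr)
      assume "\<not> ?thesis"
      then have "\<And>L. L \<subseteq> R \<Longrightarrow> L \<noteq> {} \<Longrightarrow> \<exists>v\<in>L. 2 * a \<le> degree_in E L v + 2 * degree_in E (R - L) v"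
        by (meson not_le)
      then have "2 * (2 * a) * card R \<le> 3 * (\<Sum>v\<in>R. degree_in E R v) + 4 * (\<Sum>v\<in>R. degree_in E (R - R) v)"
        using psubset.hyps assms(2,3) by (intro peeling_bound) auto
      then show False
        using psubset.prems[of R] False by (simp add: degree_in_def)
    qed
    then obtain L where L: "L \<subseteq> R" "L \<noteq> {}"
        and low: "\<And>v. v \<in> L \<Longrightarrow> degree_in E L v + 2 * degree_in E (R - L) v < 2 * a"
      by blast
    have fin: "finite L" "finite (R - L)"
      using L psubset.hyps finite_subset by auto
    have "R - L \<subset> R"
      using L by auto
    then obtain c0 where c0: "\<And>v. v \<in> R - L \<Longrightarrow> c0 v \<in> {1..a}"
        "\<And>v. v \<in> R - L \<Longrightarrow> degree_in (\<lambda>x y. E x y \<and> c0 x = c0 y) (R - L) v \<le> 1"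
      using psubset.IH[of "R - L"] psubset.prems by blast
    \<comment> \<open>The list of \<open>v\<close> omits the colors of its h neighbors outside
      \<open>L\<close>, so it has at least a - h colors; l + 2h < 2a then gives l < 2(a - h), as
      list coloring with \<open>d = 1\<close> requires.\<close>
    define F where "F v = {1..a} - c0 ` {u \<in> R - L. E v u}" for v
    have "degree_in E L v < Suc 1 * card (F v)" if v: "v \<in> L" for v
    proof -
      have "a - card (c0 ` {u \<in> R - L. E v u}) \<le> card (F v)"
        unfolding F_def using fin diff_card_le_card_Diff[of "c0 ` {u \<in> R - L. E v u}" "{1..a}"] by simp
      moreover have "card (c0 ` {u \<in> R - L. E v u}) \<le> degree_in E (R - L) v"
        unfolding degree_in_def using fin by (intro card_image_le) simp
      ultimately show ?thesis
        using low[OF v] by simp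
    qed
    then obtain c1 where c1: "\<And>v. v \<in> L \<Longrightarrow> c1 v \<in> F v"
        "\<And>v. v \<in> L \<Longrightarrow> degree_in (\<lambda>x y. E x y \<and> c1 x = c1 y) L v \<le> 1"
      using defective_list_coloring[OF fin(1) assms(2,3), of F 1] by (auto simp: F_def)
    define c where "c v = (if v \<in> L then c1 v else c0 v)" for v
    \<comment> \<open>No edge between \<open>L\<close> and \<open>R - L\<close> is monochromatic, so
      the defects of the two colorings do not add up.\<close>
    have cross: "c u \<noteq> c v" if "u \<in> R - L" "v \<in> L" "E v u" for u v
      using c1(1)[OF that(2)] that by (force simp: c_def F_def)
    have "c v \<in> {1..a} \<and> degree_in (\<lambda>x y. E x y \<and> c x = c y) R v \<le> 1" if v: "v \<in> R" for v
    proof (cases "v \<in> L")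
      case True
      have "u \<in> L" if "u \<in> R" "E v u" "c v = c u" for u
        using cross[of u v] that True by auto
      then have "{u \<in> R. E v u \<and> c v = c u} = {u \<in> L. E v u \<and> c v = c u}"
        using L by blast
      also have "\<dots> = {u \<in> L. E v u \<and> c1 v = c1 u}"
        using True by (auto simp: c_def)
      finally have "{u \<in> R. E v u \<and> c v = c u} = {u \<in> L. E v u \<and> c1 v = c1 u}" .
      then show ?thesis
        using c1[OF True] True by (simp add: degree_in_def c_def F_def)
    next
      case False
      have "u \<notin> L" if "u \<in> R" "E v u" "c v = c u" for u
        using cross[of v u] that False v sympD[OF assms(2), of v u] by auto
      then have "{u \<in> R. E v u \<and> c v = c u} = {u \<in> R - L. E v u \<and> c v = c u}"
        by blast
      also have "\<dots> = {u \<in> R - L. E v u \<and> c0 v = c0 u}"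
        using False by (auto simp: c_def)
      finally have "{u \<in> R. E v u \<and> c v = c u} = {u \<in> R - L. E v u \<and> c0 v = c0 u}" .
      then show ?thesis
        using c0[of v] False v by (simp add: degree_in_def c_def)
    qed
    then show ?thesis
      by blast
  qed simp
qed

section \<open>Edge splittings with small loads\<close>

text \<open>This is the first-order condition at a one-sided minimum. If \<open>P < 0\<close>, then
  any positive \<open>t \<le> - P / Q\<close> gives
  \<open>2 * P + t * Q \<le> P < 0\<close>.\<close>

lemma nonneg_slope_of_quadratic:
  fixes P Q d :: real
  assumes "d > 0" "Q > 0" and q: "\<And>t. 0 < t \<Longrightarrow> t \<le> d \<Longrightarrow> 0 \<le> 2 * t * P + t\<^sup>2 * Q"
  shows "0 \<le> P"
proof (rule ccontr)
  assume "\<not> 0 \<le> P"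
  define t where "t = min d (- P / Q)"
  have t: "0 < t" "t \<le> d" "t * Q \<le> - P"
    using assms(1,2) \<open>\<not> 0 \<le> P\<close> by (auto simp: t_def min_def field_simps)
  have "2 * P + t * Q < 0"
    using t(3) \<open>\<not> 0 \<le> P\<close> by linarith
  then have "t * (2 * P + t * Q) < 0"
    using t(1) by (simp add: mult_pos_neg)
  then show False
    using q[OF t(1,2)] by (simp add: power2_eq_square algebra_simps)
qed

text \<open>Shares are indexed by all pairs of the type, possibly infinitely many. Compactness
  therefore comes from Tychonoff: the splittings form a closed subset of a product of intervals
  \<open>{0..2}\<close>.\<close>

lemma compact_edge_splittings:
  "compact {f :: 'a \<times> 'a \<Rightarrow> real.
     (\<forall>p. 0 \<le> f p) \<and> (\<forall>u v. f (u, v) + f (v, u) = 2 * of_bool (E u v))}"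
  (is "compact ?K")
proof -
  have "compactin (product_topology (\<lambda>_. euclidean) UNIV) (Pi\<^sub>E UNIV (\<lambda>_::'a \<times> 'a. {0..2::real}))"
    by (simp add: compactin_PiE)
  then have box: "compact (Pi\<^sub>E UNIV (\<lambda>_::'a \<times> 'a. {0..2::real}))"
    by (simp add: euclidean_product_topology)
  have cont: "continuous_on UNIV (\<lambda>f :: 'a \<times> 'a \<Rightarrow> real. f p)" for p
    by simp
  have "closed {f :: 'a \<times> 'a \<Rightarrow> real. \<forall>p. 0 \<le> f p}"
    by (intro closed_Collect_all closed_Collect_le cont continuous_on_const)
  moreover have "closed {f :: 'a \<times> 'a \<Rightarrow> real. \<forall>u v. f (u, v) + f (v, u) = 2 * of_bool (E u v)}"
    by (intro closed_Collect_all closed_Collect_eq continuous_on_add cont continuous_on_const)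
  ultimately have "closed ?K"
    by (simp add: Collect_conj_eq closed_Int)
  moreover have "?K \<subseteq> Pi\<^sub>E UNIV (\<lambda>_. {0..2})"
  proof
    fix f assume f: "f \<in> ?K"
    have "f (u, v) \<le> 2" for u v
    proof -
      have "f (u, v) + f (v, u) \<le> 2" "0 \<le> f (v, u)"
        using f by auto
      then show ?thesis by linarith
    qed
    then show "f \<in> Pi\<^sub>E UNIV (\<lambda>_. {0..2})"
      using f by auto
  qed
  ultimately show ?thesis
    using compact_Int_closed[OF box, of ?K] by (simp add: inf.absorb2)
qed

lemma sum_pair_delta:
  fixes g :: "'a \<Rightarrow> 'a \<Rightarrow> real"
  assumes "finite V" "u \<in> V" "v \<in> V"
  shows "(\<Sum>x\<in>V. \<Sum>y\<in>V. g x y * of_bool ((x, y) = (u, v))) = g u v"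
proof -
  have "(\<Sum>y\<in>V. g x y * of_bool ((x, y) = (u, v))) = (if x = u then g u v else 0)" for x
  proof -
    have "(\<Sum>y\<in>V. g x y * of_bool ((x, y) = (u, v))) = (\<Sum>y\<in>V. if y = v then (if x = u then g u v else 0) else 0)"
      by (intro sum.cong) auto
    then show ?thesis
      using assms by simp
  qed
  then show ?thesis
    using assms by simp
qed

text \<open>The share of \<open>v\<close> in the edge \<open>vu\<close> is \<open>f (v, u)\<close>.
  The set \<open>V\<close> is a parameter so that loads can be restricted to subsets.\<close>

definition load :: "('a \<times> 'a \<Rightarrow> real) \<Rightarrow> 'a set \<Rightarrow> 'a \<Rightarrow> real" where
  "load f V v = (\<Sum>u\<in>V. f (v, u))"

text \<open>The \<open>\<epsilon>\<close>-term breaks the ties of the first one: it forces the larger share of an edge onto the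
  endpoint with the smaller load.\<close>

definition energy :: "real \<Rightarrow> 'a set \<Rightarrow> ('a \<times> 'a \<Rightarrow> real) \<Rightarrow> real" where
  "energy \<epsilon> V f = (\<Sum>x\<in>V. (load f V x)\<^sup>2) + \<epsilon> * (\<Sum>x\<in>V. \<Sum>y\<in>V. (f (x, y))\<^sup>2)"

text \<open>Moving \<open>t\<close> units of the edge \<open>uv\<close> from \<open>u\<close> to
  \<open>v\<close> changes two loads and two shares, each by \<open>t\<close>; this explains the
  quadratic coefficient \<open>2 + 2 * \<epsilon>\<close>.\<close>

lemma energy_shift:
  assumes "finite V" "u \<in> V" "v \<in> V" "u \<noteq> v"
  shows "energy \<epsilon> V (\<lambda>p. f p + t * (of_bool (p = (v, u)) - of_bool (p = (u, v)))) =
    energy \<epsilon> V f + 2 * t * (load f V v - load f V u + \<epsilon> * (f (v, u) - f (u, v))) + t\<^sup>2 * (2 + 2 * \<epsilon>)"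
proof -
  define g where "g p = of_bool (p = (v, u)) - (of_bool (p = (u, v)) :: real)" for p
  have Lg: "load g V x = of_bool (x = v) - of_bool (x = u)" for x
  proof -
    have *: "(\<Sum>y\<in>V. of_bool ((x, y) = (p, q))) = (of_bool (x = p) :: real)" if "q \<in> V" for p q
    proof -
      have "(\<Sum>y\<in>V. of_bool ((x, y) = (p, q))) = (\<Sum>y\<in>V. if y = q then of_bool (x = p) else (0::real))"
        by (intro sum.cong) auto
      then show ?thesis
        using that assms(1) by simp
    qed
    show ?thesis
      using assms by (simp only: load_def g_def sum_subtractf *)
  qed
  have shift: "load (\<lambda>p. f p + t * g p) V x = load f V x + t * load g V x" for x
    by (simp add: load_def sum.distrib sum_distrib_left)
  have "(\<Sum>x\<in>V. (load (\<lambda>p. f p + t * g p) V x)\<^sup>2) =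
      (\<Sum>x\<in>V. (load f V x)\<^sup>2 + 2 * t * (of_bool (x = v) * load f V x - of_bool (x = u) * load f V x)
        + t\<^sup>2 * (of_bool (x = v) + of_bool (x = u)))"
    using assms(4) unfolding shift by (intro sum.cong refl) (auto simp: Lg power2_eq_square algebra_simps)
  also have "\<dots> = (\<Sum>x\<in>V. (load f V x)\<^sup>2) + 2 * t * (load f V v - load f V u) + t\<^sup>2 * 2"
    using assms by (simp add: sum.distrib sum_subtractf flip: sum_distrib_left)
  finally have 1: "(\<Sum>x\<in>V. (load (\<lambda>p. f p + t * g p) V x)\<^sup>2) =
    (\<Sum>x\<in>V. (load f V x)\<^sup>2) + 2 * t * (load f V v - load f V u) + t\<^sup>2 * 2" .
  have "(\<Sum>x\<in>V. \<Sum>y\<in>V. (f (x, y) + t * g (x, y))\<^sup>2) =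
    (\<Sum>x\<in>V. \<Sum>y\<in>V. (f (x, y))\<^sup>2 + ((2 * t * f (x, y) + t\<^sup>2) * of_bool ((x, y) = (v, u))
        + (t\<^sup>2 - 2 * t * f (x, y)) * of_bool ((x, y) = (u, v))))"
    using assms(4) by (intro sum.cong refl) (auto simp: g_def power2_eq_square algebra_simps)
  also have "\<dots> = (\<Sum>x\<in>V. \<Sum>y\<in>V. (f (x, y))\<^sup>2) + (2 * t * f (v, u) + t\<^sup>2) + (t\<^sup>2 - 2 * t * f (u, v))"
    using assms by (simp only: sum.distrib sum_pair_delta)
  finally have 2: "(\<Sum>x\<in>V. \<Sum>y\<in>V. (f (x, y) + t * g (x, y))\<^sup>2) =
    (\<Sum>x\<in>V. \<Sum>y\<in>V. (f (x, y))\<^sup>2) + (2 * t * f (v, u) + t\<^sup>2) + (t\<^sup>2 - 2 * t * f (u, v))" .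
  show ?thesis
    unfolding energy_def g_def[symmetric] 1 2 by (simp add: algebra_simps)
qed

text \<open>An edge inside \<open>H\<close> hands out two units in total and is counted by the
  degrees of both endpoints.\<close>

lemma sum_load_eq_sum_degree_in:
  assumes "finite H" and split: "\<And>u v. f (u, v) + f (v, u) = 2 * of_bool (E u v)"
  shows "(\<Sum>v\<in>H. load f H v) = real (\<Sum>v\<in>H. degree_in E H v)"
proof -
  have "2 * (\<Sum>v\<in>H. load f H v) = (\<Sum>v\<in>H. \<Sum>u\<in>H. f (v, u)) + (\<Sum>v\<in>H. \<Sum>u\<in>H. f (u, v))"
    unfolding load_def by (subst (2) sum.swap) simp
  also have "\<dots> = (\<Sum>v\<in>H. \<Sum>u\<in>H. 2 * of_bool (E v u))"
    by (simp only: split flip: sum.distrib)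
  finally show ?thesis
    using assms(1) by (simp add: degree_in_conv_sum flip: sum_distrib_left del: sum_of_bool_eq)
qed

lemma balanced_edge_splitting:
  fixes \<rho> \<mu> :: real
  assumes "finite V" "symp E" "irreflp E" "\<rho> < \<mu>"
    and dense: "\<And>H. H \<subseteq> V \<Longrightarrow> H \<noteq> {} \<Longrightarrow> real (\<Sum>v\<in>H. degree_in E H v) \<le> \<rho> * card H"
  obtains f where "\<And>p. 0 \<le> f p"
    and "\<And>u v. f (u, v) + f (v, u) = 2 * of_bool (E u v)"
    and "\<And>v. v \<in> V \<Longrightarrow> load f V v < \<mu>"
    and "\<And>u v. u \<in> V \<Longrightarrow> v \<in> V \<Longrightarrow> E u v \<Longrightarrow> load f V v \<le> load f V u \<Longrightarrow> 1 \<le> f (v, u)"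
proof -
  \<comment> \<open>Loads will be compared along walks of at most \<open>card (V \<times> V)\<close>
    arcs with an error of \<open>2 * \<epsilon>\<close> per arc; this choice keeps the total error
    below \<open>\<mu> - \<rho>\<close>.\<close>
  define \<epsilon> where "\<epsilon> = (\<mu> - \<rho>) / (2 * (real (card (V \<times> V)) + 1))"
  have eps: "\<epsilon> > 0"
    using assms(4) unfolding \<epsilon>_def by (intro divide_pos_pos) auto
  define K where "K = {f :: 'a \<times> 'a \<Rightarrow> real.
    (\<forall>p. 0 \<le> f p) \<and> (\<forall>u v. f (u, v) + f (v, u) = 2 * of_bool (E u v))}"
  have cont: "continuous_on K (\<lambda>f :: 'a \<times> 'a \<Rightarrow> real. f p)" for p
    by (rule continuous_on_subset[OF continuous_on_product_coordinates]) simp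
  \<comment> \<open>The even split, one unit to each endpoint, shows that \<open>K\<close> is
    nonempty.\<close>
  have "(\<lambda>(u, v). of_bool (E u v)) \<in> K"
    using assms(2) by (auto simp: K_def dest: sympD)
  moreover have "compact K"
    unfolding K_def by (rule compact_edge_splittings)
  moreover have "continuous_on K (energy \<epsilon> V)"
    unfolding energy_def load_def by (intro continuous_intros cont)
  ultimately obtain f where f: "f \<in> K" and min: "\<And>f'. f' \<in> K \<Longrightarrow> energy \<epsilon> V f \<le> energy \<epsilon> V f'"
    using continuous_attains_inf[of K "energy \<epsilon> V"] by blast
  have nonneg: "0 \<le> f p" and split: "f (u, v) + f (v, u) = 2 * of_bool (E u v)" for p u v
    using f by (simp_all add: K_def del: split_paired_All)
  have diag: "f (u, u) = 0" for u
    using split[of u u] assms(3) by (simp add: irreflp_def)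
  \<comment> \<open>As long as \<open>t \<le> f (u, v)\<close>, moving \<open>t\<close> units from
    \<open>u\<close> to \<open>v\<close> stays in \<open>K\<close>, so minimality makes the slope at
    0 nonnegative.\<close>
  have slope: "load f V u - load f V v \<le> \<epsilon> * (f (v, u) - f (u, v))"
    if uv: "u \<in> V" "v \<in> V" "0 < f (u, v)" for u v
  proof -
    have ne: "u \<noteq> v"
      using uv(3) diag by auto
    have "0 \<le> load f V v - load f V u + \<epsilon> * (f (v, u) - f (u, v))"
    proof (rule nonneg_slope_of_quadratic[OF uv(3)])
      show "0 < 2 + 2 * \<epsilon>"
        using eps by simp
      fix t assume t: "0 < t" "t \<le> f (u, v)"
      let ?f = "\<lambda>p. f p + t * (of_bool (p = (v, u)) - of_bool (p = (u, v)))"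
      have "0 \<le> ?f p" for p
        using t nonneg[of p] ne by auto
      moreover have "?f (x, y) + ?f (y, x) = 2 * of_bool (E x y)" for x y
      proof -
        have "(y, x) = (v, u) \<longleftrightarrow> (x, y) = (u, v)" "(y, x) = (u, v) \<longleftrightarrow> (x, y) = (v, u)"
          by auto
        then show ?thesis
          using split[of x y] by (simp only: right_diff_distrib)
      qed
      ultimately have "?f \<in> K"
        unfolding K_def by (intro CollectI conjI allI)
      from min[OF this] show "0 \<le> 2 * t * (load f V v - load f V u + \<epsilon> * (f (v, u) - f (u, v))) + t\<^sup>2 * (2 + 2 * \<epsilon>)"
        unfolding energy_shift[OF assms(1) uv(1,2) ne] by linarith
    qed
    then show ?thesis
      by linarith
  qed
  have bound: "load f V v0 < \<mu>" if v0: "v0 \<in> V" for v0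
  proof -
    \<comment> \<open>\<open>S\<close> collects the vertices reachable from \<open>v0\<close> along
      arcs whose tail has a positive share. By \<open>slope\<close>, the load drops by at most
      \<open>2 * \<epsilon>\<close> along each such arc.\<close>
    define A where "A = {(u, v). u \<in> V \<and> v \<in> V \<and> 0 < f (u, v)}"
    define S where "S = A\<^sup>* `` {v0}"
    have A: "A \<subseteq> V \<times> V" "finite A"
      using assms(1) finite_subset[of A "V \<times> V"] by (auto simp: A_def)
    have S: "S \<subseteq> V" "v0 \<in> S"
      unfolding S_def using v0 by (auto elim: rtranclE simp: A_def)
    have finS: "finite S"
      using S assms(1) finite_subset by blast
    have step: "load f V u \<le> load f V v + 2 * \<epsilon>" if "(u, v) \<in> A" for u v
    proof -
      have "f (v, u) - f (u, v) \<le> 2"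
        using split[of u v] nonneg[of "(u, v)"] by (cases "E u v") auto
      then have "\<epsilon> * (f (v, u) - f (u, v)) \<le> \<epsilon> * 2"
        using eps by (intro mult_left_mono) auto
      then show ?thesis
        using slope[of u v] that by (auto simp: A_def)
    qed
    have pow: "load f V v0 \<le> load f V v + real n * (2 * \<epsilon>)" if "(v0, v) \<in> A ^^ n" for n v
      using that
    proof (induction n arbitrary: v)
      case (Suc n)
      then obtain w where "(v0, w) \<in> A ^^ n" "(w, v) \<in> A"
        by auto
      then show ?case
        using Suc.IH step by (fastforce simp: algebra_simps)
    qed simp
    have "load f V v0 - (\<mu> - \<rho>) < load f S v" if v: "v \<in> S" for v
    proof -
      obtain n where n: "n \<le> card A" "(v0, v) \<in> A ^^ n"
        using v unfolding S_def rtrancl_finite_eq_relpow[OF A(2)] by auto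
      have "card A \<le> card (V \<times> V)"
        using A assms(1) by (intro card_mono) auto
      then have "real n * (2 * \<epsilon>) < (real (card (V \<times> V)) + 1) * (2 * \<epsilon>)"
        using n eps by (intro mult_strict_right_mono) auto
      also have "\<dots> = \<mu> - \<rho>"
        by (simp add: \<epsilon>_def field_simps add_pos_nonneg)
      finally have "load f V v0 - (\<mu> - \<rho>) < load f V v"
        using pow[OF n(2)] by linarith
      \<comment> \<open>No arc of \<open>A\<close> leaves \<open>S\<close>, so vertices of
        \<open>S\<close> carry nothing of the edges going out of \<open>S\<close>.\<close>
      also have "load f V v = load f S v"
      proof -
        have "f (v, u) = 0" if u: "u \<in> V - S" for u
        proof (rule ccontr)
          assume "f (v, u) \<noteq> 0"
          then have "(v, u) \<in> A"
            using u v S nonneg[of "(v, u)"] by (auto simp: A_def)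
          then show False
            using u v by (auto simp: S_def intro: rtrancl_into_rtrancl)
        qed
        then show ?thesis
          unfolding load_def using S assms(1) by (intro sum.mono_neutral_right) auto
      qed
      finally show ?thesis .
    qed
    \<comment> \<open>The loads within \<open>S\<close> average at most \<open>\<rho>\<close>, yet
      each exceeds \<open>load f V v0 - (\<mu> - \<rho>)\<close>; hence
      \<open>load f V v0 < \<mu>\<close>.\<close>
    then have "(\<Sum>v\<in>S. load f V v0 - (\<mu> - \<rho>)) < (\<Sum>v\<in>S. load f S v)"
      using S finS by (intro sum_strict_mono) auto
    also have "\<dots> = real (\<Sum>v\<in>S. degree_in E S v)"
      by (rule sum_load_eq_sum_degree_in[where f=f and E=E, OF finS split])
    also have "\<dots> \<le> \<rho> * card S"
      using S by (intro dense) auto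
    finally have "card S * (load f V v0 - (\<mu> - \<rho>)) < card S * \<rho>"
      by (simp add: mult.commute)
    then show ?thesis
      by (simp add: mult_less_cancel_left)
  qed
  \<comment> \<open>If \<open>f (u, v)\<close> vanishes, \<open>v\<close> carries both units.
    Otherwise \<open>slope\<close> and the order of the loads give
    \<open>f (u, v) \<le> f (v, u)\<close>, and the two shares sum to 2.\<close>
  have "1 \<le> f (v, u)" if "u \<in> V" "v \<in> V" "E u v" "load f V v \<le> load f V u" for u v
  proof (cases "f (u, v) = 0")
    case False
    then have "0 \<le> \<epsilon> * (f (v, u) - f (u, v))"
      using slope[of u v] that nonneg[of "(u, v)"] by force
    then show ?thesis
      using eps split[of u v] that by (simp add: zero_le_mult_iff)
  qed (use split[of u v] that in auto)
  with bound nonneg split show thesis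
    using that by blast
qed

section \<open>Greedy independent sets\<close>

text \<open>Vertices are processed in order of decreasing \<open>r\<close> and taken unless they
  have a neighbor already chosen. Such a neighbor has at least the same rank, so \<open>dom\<close>
  applies to it.\<close>

lemma dominating_independent_set:
  fixes r :: "'a \<Rightarrow> real"
  assumes "finite V" "symp E" "irreflp E"
    and dom: "\<And>u v. u \<in> V \<Longrightarrow> v \<in> V \<Longrightarrow> E u v \<Longrightarrow> r v \<le> r u \<Longrightarrow> P v u"
  shows "\<exists>I\<subseteq>V. (\<forall>u\<in>I. \<forall>v\<in>I. \<not> E u v) \<and> (\<forall>v\<in>V - I. \<exists>u\<in>I. P v u)"
  using assms(1,4)
proof (induction V rule: finite_ranking_induct[where f="\<lambda>v. - r v"])
  case (insert x S)
  obtain I where I: "I \<subseteq> S" "\<forall>u\<in>I. \<forall>v\<in>I. \<not> E u v" "\<forall>v\<in>S - I. \<exists>u\<in>I. P v u"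
    using insert.IH insert.prems by auto
  show ?case
  proof (cases "\<exists>u\<in>I. E u x")
    case True
    then obtain u where u: "u \<in> I" "E u x"
      by blast
    have "P x u"
      using u I insert.hyps(2)[of u] by (intro insert.prems) auto
    then show ?thesis
      using I u by (intro exI[of _ I]) auto
  next
    case False
    then have "\<forall>u\<in>insert x I. \<forall>v\<in>insert x I. \<not> E u v"
      using I(2) assms(2,3) by (auto dest: sympD irreflpD)
    then show ?thesis
      using I by (intro exI[of _ "insert x I"]) auto
  qed
qed simp

text \<open>One ranking \<open>r\<close> serves all rounds, since \<open>dom\<close> restricts to
  the vertices that remain. In each round a remaining vertex loses its share, at least 1, of some
  edge to the new set.\<close>

lemma iterated_dominating_independent_sets:
  fixes f :: "'a \<times> 'a \<Rightarrow> real" and r :: "'a \<Rightarrow> real"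
  assumes "finite V" "symp E" "irreflp E" "\<And>p. 0 \<le> f p"
    and dom: "\<And>u v. u \<in> V \<Longrightarrow> v \<in> V \<Longrightarrow> E u v \<Longrightarrow> r v \<le> r u \<Longrightarrow> 1 \<le> f (v, u)"
  shows "\<exists>Os :: nat \<Rightarrow> 'a set. disjoint_family_on Os {1..b} \<and>
    (\<forall>j\<in>{1..b}. Os j \<subseteq> V \<and> (\<forall>u\<in>Os j. \<forall>v\<in>Os j. \<not> E u v)) \<and>
    (\<forall>v\<in>V - (\<Union>j\<in>{1..b}. Os j). load f (V - (\<Union>j\<in>{1..b}. Os j)) v \<le> load f V v - real b)"
proof (induction b)
  case 0
  show ?case
    by (simp add: disjoint_family_on_def)
next
  case (Suc b)
  then obtain Os :: "nat \<Rightarrow> 'a set" where Os: "disjoint_family_on Os {1..b}"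
    "\<And>j. j \<in> {1..b} \<Longrightarrow> Os j \<subseteq> V \<and> (\<forall>u\<in>Os j. \<forall>v\<in>Os j. \<not> E u v)"
    "\<And>v. v \<in> V - (\<Union>j\<in>{1..b}. Os j) \<Longrightarrow>
       load f (V - (\<Union>j\<in>{1..b}. Os j)) v \<le> load f V v - real b"
    by blast
  define R where "R = V - (\<Union>j\<in>{1..b}. Os j)"
  have "finite R"
    using assms(1) by (simp add: R_def)
  then have "\<exists>I\<subseteq>R. (\<forall>u\<in>I. \<forall>v\<in>I. \<not> E u v) \<and> (\<forall>v\<in>R - I. \<exists>u\<in>I. 1 \<le> f (v, u))"
    using dom by (intro dominating_independent_set[where r=r] assms) (auto simp: R_def)
  then obtain I where I: "I \<subseteq> R" "\<forall>u\<in>I. \<forall>v\<in>I. \<not> E u v" "\<forall>v\<in>R - I. \<exists>u\<in>I. 1 \<le> f (v, u)"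
    by blast
  define Os' where "Os' = Os(Suc b := I)"
  have Os'_eq: "Os' j = Os j" if "j \<in> {1..b}" for j
    using that by (simp add: Os'_def)
  have ins: "{1..Suc b} = insert (Suc b) {1..b}"
    by auto
  have Un: "V - (\<Union>j\<in>{1..Suc b}. Os' j) = R - I"
    unfolding ins by (auto simp: Os'_def R_def)
  have "disjoint_family_on Os' {1..b}"
    using Os(1) Os'_eq unfolding disjoint_family_on_def by metis
  moreover have "Os' (Suc b) \<inter> (\<Union>j\<in>{1..b}. Os' j) = {}"
    using I(1) by (auto simp: Os'_def R_def)
  ultimately have "disjoint_family_on Os' {1..Suc b}"
    unfolding ins by (subst disjoint_family_on_insert) auto
  moreover have "\<forall>j\<in>{1..Suc b}. Os' j \<subseteq> V \<and> (\<forall>u\<in>Os' j. \<forall>v\<in>Os' j. \<not> E u v)"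
    unfolding ins using Os(2) I(1,2) by (auto simp: Os'_def R_def)
  moreover have "load f (R - I) v \<le> load f V v - real (Suc b)" if v: "v \<in> R - I" for v
  proof -
    obtain u where u: "u \<in> I" "1 \<le> f (v, u)"
      using I(3) v by blast
    have finI: "finite I"
      using I(1) \<open>finite R\<close> finite_subset by blast
    have "f (v, u) \<le> load f I v"
      unfolding load_def using assms(4) u finI by (intro member_le_sum) auto
    moreover have "load f R v = load f (R - I) v + load f I v"
      unfolding load_def using I(1) \<open>finite R\<close> by (rule sum.subset_diff)
    moreover have "load f R v \<le> load f V v - real b"
      using Os(3)[of v] v by (simp add: R_def)
    ultimately show ?thesis
      using u(2) by simp
  qed
  ultimately show ?case
    by (intro exI[of _ Os']) (simp only: Un, simp)
qed

section \<open>From the maximum average degree to the coloring\<close>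

text \<open>The subgraph \<open>K\<close> induced on \<open>H\<close> competes in the maximum
  defining \<open>mad G\<close>, and the degree sum counts its arcs.\<close>

lemma sum_degree_in_le_mad:
  assumes "pair_graph G" "H \<subseteq> pverts G" "H \<noteq> {}"
  shows "real (\<Sum>v\<in>H. degree_in (\<lambda>u v. (u, v) \<in> parcs G) H v) \<le> mad G * card H"
proof -
  interpret pair_graph G by fact
  define A where "A = {(u, v) \<in> parcs G. u \<in> H \<and> v \<in> H}"
  define K where "K = \<lparr>pverts = H, parcs = A\<rparr>"
  have finH: "finite H"
    using assms(2) pair_finite_verts finite_subset by blast
  have A: "A \<subseteq> parcs G" "finite A"
    using pair_finite_arcs finite_subset[of A "parcs G"] by (auto simp: A_def)
  have sym: "(v, u) \<in> parcs G" if "(u, v) \<in> parcs G" for u v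
    using that pair_sym_arcs by (auto simp: symmetric_def sym_def arcs_ends_def arc_to_ends_def)
  have "pair_graph K"
  proof unfold_locales
    show "symmetric (with_proj K)"
      using sym by (auto simp: K_def A_def symmetric_def arcs_ends_def arc_to_ends_def intro!: symI)
  qed (use finH A(2) pair_no_loops in \<open>simp_all add: K_def, auto simp: A_def\<close>)
  moreover have "subgraph (with_proj K) (with_proj G)"
  proof -
    interpret K: pair_graph K by fact
    show ?thesis
      using assms(2) A(1) K.wf_digraph_axioms wf_digraph_axioms
      by (auto simp: subgraph_def compatible_def K_def)
  qed
  ultimately have "average_degree K \<le> mad G"
    unfolding mad_def using finite_subgraphs[OF assms(1)]
    by (intro Max_ge) (auto simp: subgraphs_def)
  then have avg: "2 * real (card (uedges K)) \<le> mad G * card H"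
    using finH assms(3) by (simp add: average_degree_def K_def card_gt_0_iff divide_simps split: if_splits)
  have "(\<Sum>v\<in>H. degree_in (\<lambda>u v. (u, v) \<in> parcs G) H v) = card (SIGMA v:H. {u \<in> H. (v, u) \<in> parcs G})"
    using finH by (simp add: degree_in_def)
  also have "(SIGMA v:H. {u \<in> H. (v, u) \<in> parcs G}) = A"
    by (auto simp: A_def)
  \<comment> \<open>Each fiber of the map from arcs to undirected edges contains at most an arc and
    its reverse.\<close>
  also have "card A \<le> card (uedges K) * 2"
  proof -
    have "card A = card (\<Union>e\<in>uedges K. {p \<in> A. (\<lambda>(u, v). {u, v}) p = e})"
      by (intro arg_cong[where f=card]) (auto simp: uedges_def K_def)
    also have "\<dots> \<le> (\<Sum>e\<in>uedges K. card {p \<in> A. (\<lambda>(u, v). {u, v}) p = e})"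
      using A(2) by (intro card_UN_le) (simp add: uedges_def K_def)
    also have "\<dots> \<le> (\<Sum>e\<in>uedges K. 2)"
    proof (rule sum_mono)
      fix e assume "e \<in> uedges K"
      then obtain u v where e: "e = {u, v}"
        by (auto simp: uedges_def)
      have "{p \<in> A. (\<lambda>(u, v). {u, v}) p = e} \<subseteq> {(u, v), (v, u)}"
      proof
        fix p assume "p \<in> {p \<in> A. (\<lambda>(u, v). {u, v}) p = e}"
        then have "{fst p, snd p} = {u, v}"
          unfolding e by (simp add: case_prod_unfold)
        then have "(fst p, snd p) \<in> {(u, v), (v, u)}"
          unfolding doubleton_eq_iff by blast
        then show "p \<in> {(u, v), (v, u)}"
          by simp
      qed
      then have "card {p \<in> A. (\<lambda>(u, v). {u, v}) p = e} \<le> card {(u, v), (v, u)}"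
        by (intro card_mono) simp_all
      also have "\<dots> \<le> 2"
        by (intro card_insert_le_m1) simp_all
      finally show "card {p \<in> A. (\<lambda>(u, v). {u, v}) p = e} \<le> 2" .
    qed
    finally show ?thesis
      by simp
  qed
  finally have "real (\<Sum>v\<in>H. degree_in (\<lambda>u v. (u, v) \<in> parcs G) H v) \<le> 2 * real (card (uedges K))"
    by linarith
  with avg show ?thesis
    by linarith
qed

theorem theorem1:
  fixes G :: "'a pair_pre_digraph" and a b :: nat
  assumes "pair_graph G"
    and "a \<ge> 1"
    and "mad G < 4 / 3 * real a + real b"
  shows "defective_colorable 1 a b G"
proof -
  interpret pair_graph G by fact
  define V where "V = pverts G"
  define E where "E u v \<longleftrightarrow> (u, v) \<in> parcs G" for u v
  have E: "finite V" "symp E" "irreflp E"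
    using pair_finite_verts pair_sym_arcs pair_no_loops[of "(v, v)" for v]
    by (auto simp: V_def E_def symp_def irreflp_def symmetric_def sym_def arcs_ends_def arc_to_ends_def)
  have "real (\<Sum>v\<in>H. degree_in E H v) \<le> mad G * card H" if "H \<subseteq> V" "H \<noteq> {}" for H
    using sum_degree_in_le_mad[OF assms(1)] that by (simp add: V_def E_def[abs_def])
  then obtain f where f: "\<And>p. 0 \<le> f p"
      "\<And>u v. f (u, v) + f (v, u) = 2 * of_bool (E u v)"
      "\<And>v. v \<in> V \<Longrightarrow> load f V v < 4 / 3 * real a + real b"
      "\<And>u v. u \<in> V \<Longrightarrow> v \<in> V \<Longrightarrow> E u v \<Longrightarrow> load f V v \<le> load f V u \<Longrightarrow> 1 \<le> f (v, u)"
    using balanced_edge_splitting[OF E assms(3)] by blast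
  obtain Os :: "nat \<Rightarrow> 'a set" where Os: "disjoint_family_on Os {1..b}"
    "\<forall>j\<in>{1..b}. Os j \<subseteq> V \<and> (\<forall>u\<in>Os j. \<forall>v\<in>Os j. \<not> E u v)"
    "\<forall>v\<in>V - (\<Union>j\<in>{1..b}. Os j).
       load f (V - (\<Union>j\<in>{1..b}. Os j)) v \<le> load f V v - real b"
    by (rule exE[OF iterated_dominating_independent_sets[OF E, of f "load f V" b]], rule f(1),
      rule f(4), assumption+, elim conjE, rule that)
  define R where "R = V - (\<Union>j\<in>{1..b}. Os j)"
  have finR: "finite R"
    using E(1) by (simp add: R_def)
  \<comment> \<open>Restricting to \<open>H\<close> cannot increase a load, and on \<open>R\<close>
    the loads have dropped by \<open>b\<close>, so all are below \<open>4a/3\<close>. Summing over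
    \<open>H\<close> turns this into a bound on the degree sum.\<close>
  have "3 * (\<Sum>v\<in>H. degree_in E H v) < 4 * a * card H" if H: "H \<subseteq> R" "H \<noteq> {}" for H
  proof -
    have finH: "finite H"
      using H finR finite_subset by blast
    have "load f H v < 4 / 3 * real a" if v: "v \<in> H" for v
    proof -
      have "load f H v \<le> load f R v"
        unfolding load_def using H finR f(1) by (intro sum_mono2) auto
      also have "\<dots> \<le> load f V v - real b"
        using v H bspec[OF Os(3), of v] by (auto simp: R_def)
      also have "\<dots> < 4 / 3 * real a"
        using v H f(3)[of v] by (force simp: R_def)
      finally show ?thesis .
    qed
    then have "(\<Sum>v\<in>H. load f H v) < (\<Sum>v\<in>H. 4 / 3 * real a)"
      using finH H by (intro sum_strict_mono)
    then have "3 * real (\<Sum>v\<in>H. degree_in E H v) < 4 * real a * real (card H)"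
      unfolding sum_load_eq_sum_degree_in[where f=f and E=E, OF finH f(2)] by (simp add: mult_ac)
    then have "real (3 * (\<Sum>v\<in>H. degree_in E H v)) < real (4 * a * card H)"
      by simp
    then show ?thesis
      by (simp only: of_nat_less_iff)
  qed
  then have "\<exists>c. \<forall>v\<in>R. c v \<in> {1..a} \<and> degree_in (\<lambda>x y. E x y \<and> c x = c y) R v \<le> 1"
    using finR E(2,3) by (intro defective_1_coloring)
  then obtain c where c: "\<And>v. v \<in> R \<Longrightarrow> c v \<in> {1..a}"
      "\<And>v. v \<in> R \<Longrightarrow> degree_in (\<lambda>x y. E x y \<and> c x = c y) R v \<le> 1"
    by blast
  define Ds where "Ds i = {v \<in> R. c v = i}" for i
  have "(\<Union>i\<in>{1..a}. Ds i) = R"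
    using c(1) by (auto simp: Ds_def)
  moreover have "disjoint_family_on Ds {1..a}"
    by (auto simp: disjoint_family_on_def Ds_def)
  moreover have "R \<union> (\<Union>j\<in>{1..b}. Os j) = pverts G" "R \<inter> (\<Union>j\<in>{1..b}. Os j) = {}"
    using Os(2) by (auto simp: R_def V_def)
  moreover have "\<forall>j\<in>{1..b}. independent_set G (Os j)"
    using Os(2) by (simp add: independent_set_def V_def E_def)
  moreover have "max_degree_at_most (with_proj G \<restriction> Ds i) 1" for i
    unfolding max_degree_at_most_def
  proof
    fix v assume "v \<in> verts (with_proj G \<restriction> Ds i)"
    then have v: "v \<in> R" "c v = i"
      by (auto simp: Ds_def)
    \<comment> \<open>Arcs leaving \<open>v\<close> within its class correspond to its neighbors in
      \<open>R\<close> of the same color.\<close>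
    have "out_arcs (with_proj G \<restriction> Ds i) v = Pair v ` {u \<in> R. E v u \<and> c v = c u}"
      using v by (auto simp: out_arcs_def Ds_def E_def)
    then have "out_degree (with_proj G \<restriction> Ds i) v = degree_in (\<lambda>x y. E x y \<and> c x = c y) R v"
      by (simp add: out_degree_def degree_in_def card_image inj_on_def)
    then show "out_degree (with_proj G \<restriction> Ds i) v \<le> 1"
      using c(2)[OF v(1)] by simp
  qed
  ultimately show ?thesis
    unfolding defective_colorable_def using Os(1) by (intro exI[of _ Ds] exI[of _ Os]) simp
qed

end
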